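(* Let $A=MP+\varepsilon D$. Then, as $\varepsilon\to0$, the spectrum of $A$ satisfies $$\mathrm{Sp}(A)\subset \mathcal{D}\Big(0,\ \varepsilon\, C\max_{j\in\mathcal{J}^+}(|\alpha_j|+|\beta_j|)\Big)\cup\{\lambda(\varepsilon)\},$$ where the constant $C$ depends on the parameters $(\alpha_j)_{j=1}^J$ and $(\beta_j)_{j=1}^J$ of the spatial discretisation scheme and on the chosen velocities $(v_j)_{j=1}^J$. The dominant eigenvalue $\lambda(\varepsilon)$ is simple and can be expanded as $$\mathrm{Re}(\lambda(\varepsilon))=1+\varepsilon\langle\alpha\rangle+\varepsilon^2\Big(\big\langle(\langle\alpha\rangle-\alpha)^2\big\rangle-\langle\beta^2\rangle+\delta_\gamma\Big\langle\frac{\beta}{v}\Big\rangle^2\Big)+o(\varepsilon^2),$$ $$\mathrm{Im}(\lambda(\varepsilon))=\varepsilon\,\delta_\gamma\Big\langle\frac{\beta}{v}\Big\rangle+\varepsilon^2\Big(\delta_\gamma\Big\langle\Big(\Big\langle\frac{\beta}{v}\Big\rangle-\beta\Big)\big(\langle\alpha\rangle-\alpha\big)\Big\rangle+\delta_{\gamma-1}\Big\langle\frac{\beta}{v}\Big\rangle\Big)+o(\varepsilon^2).$$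
   Context: Let $\gamma\in\{0,1\}$ ($\gamma=0$: hyperbolic scaling, $\gamma=1$: parabolic scaling), $\varepsilon>0$, $J$ even, and let $v_1,\dots,v_J$ be distinct nonzero real velocities that are symmetric: $v_{J+1-j}=-v_j$ for $1\le j\le J/2$, labelled so that $\mathcal{J}^+=\{J/2+1,\dots,J\}$ is the set of indices of positive velocities. Put $V=\mathrm{diag}(v_1,\dots,v_J)$, $e=\frac1{\sqrt J}(1,\dots,1)^T\in\mathbb{R}^J$, $P=ee^T$, $M=\mathcal{I}+\varepsilon^\gamma V^{-1}$ with $\mathcal{I}$ the $J\times J$ identity ($M$ is assumed invertible). For a vector $h=(h_j)_{j=1}^J$, $\langle h\rangle=\frac1J\sum_{j=1}^J h_j$; products and quotients such as $\beta^2$, $\beta/v$ are taken componentwise. The diagonal matrix $D=\mathrm{diag}(D_1,\dots,D_J)$, $D_j=\alpha_j+i\beta_j$, is minus the Fourier symbol, at a fixed frequency $\zeta\in\mathbb{R}$ and mesh width $\Delta x>0$, of the spatial discretisation of $v\partial_x$, which is either the third order upwind-biased scheme (used in the hyperbolic scaling), $$\alpha_j=-\frac{|v_j|}{6\Delta x}(3-4\cos\zeta+\cos2\zeta),\qquad \beta_j=-\frac{v_j}{6\Delta x}(8\sin\zeta-\sin2\zeta),$$ or the fourth order central scheme (used in the parabolic scaling), $$\alpha_j=0,\qquad \beta_j=-v_j\frac{8\sin\zeta-\sin2\zeta}{6\Delta x}.$$ In particular $D_{J+1-j}=\overline{D_j}$. $\mathcal{D}(c,r)$ is the closed disc in $\mathbb{C}$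 with centre $c$ and radius $r$. $\delta_\gamma=1$ if $\gamma=0$ and $0$ otherwise; $\delta_{\gamma-1}=1$ if $\gamma=1$ and $0$ otherwise. *)

theory Defs
  imports
    "Jordan_Normal_Form.Spectral_Radius"
    "HOL-Analysis.Elementary_Metric_Spaces"
    "HOL-Library.Landau_Symbols"
begin

text \<open>
  Families such as the velocities are functions on the naturals of which only the values at
  \<open>1, \<dots>, J\<close> matter. Matrix entries are numbered from \<open>0\<close>, hence the shift by \<open>Suc\<close> below.
\<close>

definition diag_of :: "nat \<Rightarrow> (nat \<Rightarrow> complex) \<Rightarrow> complex mat" where
  "diag_of J d = mat_diag J (\<lambda>i. d (Suc i))"

definition avg :: "nat \<Rightarrow> (nat \<Rightarrow> real) \<Rightarrow> real" where
  "avg J h = (\<Sum>j = 1..J. h j) / real J"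

text \<open>The unit vector \<open>e\<close>, as a matrix with a single column.\<close>

definition e_col :: "nat \<Rightarrow> complex mat" where
  "e_col J = mat J 1 (\<lambda>_. complex_of_real (1 / sqrt (real J)))"

definition P_mat :: "nat \<Rightarrow> complex mat" where
  "P_mat J = e_col J * transpose_mat (e_col J)"

definition V_mat :: "nat \<Rightarrow> (nat \<Rightarrow> real) \<Rightarrow> complex mat" where
  "V_mat J v = diag_of J (\<lambda>j. complex_of_real (v j))"

definition V_inv :: "nat \<Rightarrow> (nat \<Rightarrow> real) \<Rightarrow> complex mat" where
  "V_inv J v = diag_of J (\<lambda>j. complex_of_real (1 / v j))"

lemma V_inv_inverse:
  assumes "\<forall>j\<in>{1..J}. v j \<noteq> 0"
  shows "inverts_mat (V_mat J v) (V_inv J v)" "inverts_mat (V_inv J v) (V_mat J v)"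
proof -
  have d: "dim_row (mat_diag J f) = J" for f :: "nat \<Rightarrow> complex"
    using mat_diag_dim by (rule carrier_matD(1))
  have "mat_diag J (\<lambda>i. complex_of_real (v (Suc i)) * complex_of_real (1 / v (Suc i))) = 1\<^sub>m J"
    using assms by (intro eq_matI) (auto simp: mat_diag_def simp flip: of_real_mult)
  then show "inverts_mat (V_mat J v) (V_inv J v)" "inverts_mat (V_inv J v) (V_mat J v)"
    unfolding inverts_mat_def V_mat_def V_inv_def diag_of_def mat_diag_diag d
    by (simp_all only: mult.commute)
qed

definition M_mat :: "nat \<Rightarrow> nat \<Rightarrow> (nat \<Rightarrow> real) \<Rightarrow> real \<Rightarrow> complex mat" where
  "M_mat J \<gamma> v \<epsilon> = 1\<^sub>m J + complex_of_real (\<epsilon> ^ \<gamma>) \<cdot>\<^sub>m V_inv J v"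

definition D_mat :: "nat \<Rightarrow> (nat \<Rightarrow> real) \<Rightarrow> (nat \<Rightarrow> real) \<Rightarrow> complex mat" where
  "D_mat J \<alpha> \<beta> = diag_of J (\<lambda>j. Complex (\<alpha> j) (\<beta> j))"

definition A_mat ::
  "nat \<Rightarrow> nat \<Rightarrow> (nat \<Rightarrow> real) \<Rightarrow> (nat \<Rightarrow> real) \<Rightarrow> (nat \<Rightarrow> real) \<Rightarrow> real \<Rightarrow> complex mat" where
  "A_mat J \<gamma> v \<alpha> \<beta> \<epsilon> = M_mat J \<gamma> v \<epsilon> * P_mat J + complex_of_real \<epsilon> \<cdot>\<^sub>m D_mat J \<alpha> \<beta>"

text \<open>
  Minus the Fourier symbols, at frequency \<open>\<zeta>\<close> and mesh width \<open>dx\<close>, of the third order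
  upwind-biased and of the fourth order central discretisation of the transport operator.
\<close>

definition upwind3 ::
  "nat \<Rightarrow> (nat \<Rightarrow> real) \<Rightarrow> real \<Rightarrow> real \<Rightarrow> (nat \<Rightarrow> real) \<Rightarrow> (nat \<Rightarrow> real) \<Rightarrow> bool" where
  "upwind3 J v \<zeta> dx \<alpha> \<beta> \<longleftrightarrow> (\<forall>j\<in>{1..J}.
     \<alpha> j = - (\<bar>v j\<bar> / (6 * dx)) * (3 - 4 * cos \<zeta> + cos (2 * \<zeta>)) \<and>
     \<beta> j = - (v j / (6 * dx)) * (8 * sin \<zeta> - sin (2 * \<zeta>)))"

definition central4 ::
  "nat \<Rightarrow> (nat \<Rightarrow> real) \<Rightarrow> real \<Rightarrow> real \<Rightarrow> (nat \<Rightarrow> real) \<Rightarrow> (nat \<Rightarrow> real) \<Rightarrow> bool" where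
  "central4 J v \<zeta> dx \<alpha> \<beta> \<longleftrightarrow> (\<forall>j\<in>{1..J}.
     \<alpha> j = 0 \<and>
     \<beta> j = - v j * ((8 * sin \<zeta> - sin (2 * \<zeta>)) / (6 * dx)))"

text \<open>Simplicity is meant algebraically.\<close>

definition simple_eigenvalue :: "complex mat \<Rightarrow> complex \<Rightarrow> bool" where
  "simple_eigenvalue A l \<longleftrightarrow> eigenvalue A l \<and> order l (char_poly A) = 1"

definition dominant_eigenvalue :: "complex mat \<Rightarrow> complex \<Rightarrow> bool" where
  "dominant_eigenvalue A l \<longleftrightarrow> eigenvalue A l \<and> (\<forall>m\<in>spectrum A - {l}. cmod m < cmod l)"

end

theory Submission
  imports Defs
begin

text \<open>
  \<open>A\<close> is a rank one matrix plus \<open>\<epsilon> D\<close>, so an eigenvalue \<open>l\<close> that is no entry of \<open>\<epsilon> D\<close> solves the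
  secular equation \<open>\<langle>m / (l - \<epsilon> D)\<rangle> = 1\<close>, where \<open>m\<close> is the diagonal of \<open>M\<close>. Since \<open>\<langle>m\<rangle> = 1\<close> by symmetry
  of the velocities, this is the fixed point equation \<open>l = 1 + \<epsilon> \<langle>m D / (l - \<epsilon> D)\<rangle>\<close>. It forces \<open>l\<close> to be
  \<open>O(\<epsilon>)\<close>-close to \<open>0\<close> or to \<open>1\<close>, and in the second case
  \<open>l = 1 + \<epsilon> \<langle>m D\<rangle> + \<epsilon>\<^sup>2 (\<langle>m D\<^sup>2\<rangle> - \<langle>m D\<rangle>\<^sup>2) + O(\<epsilon>\<^sup>3)\<close>. In both schemes \<open>\<alpha>\<close> is a multiple of \<open>\<bar>v\<bar>\<close> and \<open>\<beta>\<close> a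
  multiple of \<open>v\<close>; this makes the second order coefficient real, and the average
  \<open>\<langle>(\<langle>\<beta> / v\<rangle> - \<beta>) (\<langle>\<alpha>\<rangle> - \<alpha>)\<rangle>\<close> in the claimed imaginary part vanish.
\<close>

section \<open>Trace and algebraic multiplicity in terms of a list of roots\<close>

lemma sum_diag_mult_commute:
  fixes A B :: "'a :: comm_semiring_0 mat"
  assumes A: "A \<in> carrier_mat n m" and B: "B \<in> carrier_mat m n"
  shows "(\<Sum>i<n. (A * B) $$ (i, i)) = (\<Sum>j<m. (B * A) $$ (j, j))"
proof -
  have "(\<Sum>i<n. (A * B) $$ (i, i)) = (\<Sum>i<n. \<Sum>j<m. A $$ (i, j) * B $$ (j, i))"
    using A B by (intro sum.cong) (auto simp: scalar_prod_def lessThan_atLeast0)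
  also have "\<dots> = (\<Sum>j<m. \<Sum>i<n. B $$ (j, i) * A $$ (i, j))"
    by (subst sum.swap) (simp add: mult.commute)
  also have "\<dots> = (\<Sum>j<m. (B * A) $$ (j, j))"
    using A B by (intro sum.cong) (auto simp: scalar_prod_def lessThan_atLeast0)
  finally show ?thesis .
qed

text \<open>Schur decomposition makes the matrix similar to one with diagonal \<open>es\<close>, and
  cyclicity of the trace makes the diagonal sum invariant under similarity.\<close>

lemma sum_diag_eq_sum_list_eigenvalues:
  fixes A :: "complex mat"
  assumes A: "A \<in> carrier_mat n n" and es: "char_poly A = (\<Prod>e\<leftarrow>es. [:- e, 1:])"
  shows "(\<Sum>i<n. A $$ (i, i)) = sum_list es"
proof -
  obtain B P Q where "schur_decomposition A es = (B, P, Q)"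
    using prod_cases3 by blast
  from schur_decomposition[OF A es this]
  have wit: "similar_mat_wit A B P Q" and diag: "diag_mat B = es" by auto
  note QP = similar_mat_witD2(2)[OF A wit] and eq = similar_mat_witD2(3)[OF A wit]
    and B = similar_mat_witD2(5)[OF A wit] and P = similar_mat_witD2(6)[OF A wit]
    and Q = similar_mat_witD2(7)[OF A wit]
  have "(\<Sum>i<n. A $$ (i, i)) = (\<Sum>i<n. (P * (B * Q)) $$ (i, i))"
    by (subst eq) (simp only: assoc_mult_mat[OF P B Q])
  also have "\<dots> = (\<Sum>i<n. ((B * Q) * P) $$ (i, i))"
    using P B Q by (intro sum_diag_mult_commute) auto
  also have "(B * Q) * P = B"
    using P B Q QP by (simp add: assoc_mult_mat[of _ n n _ n _ n])
  also have "(\<Sum>i<n. B $$ (i, i)) = sum_list es"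
    using B diag by (auto simp: diag_mat_def sum_list_sum_nth lessThan_atLeast0)
  finally show ?thesis .
qed

text \<open>Turns the algebraic multiplicity required by \<open>simple_eigenvalue\<close> into a
  count in the list of roots.\<close>

lemma order_prod_list_linear:
  fixes a :: "'a :: field"
  shows "order a (\<Prod>e\<leftarrow>es. [:- e, 1:]) = count_list es a"
proof (induction es)
  case (Cons e es)
  have "[:- e, 1:] * (\<Prod>e\<leftarrow>es. [:- e, 1:]) \<noteq> 0"
    by (simp only: mult_eq_0_iff prod_list_zero_iff) auto
  from order_mult[OF this, of a] Cons show ?case
    by (simp add: order_linear' del: mult_pCons_left)
qed simp

section \<open>The secular equation and its solutions\<close>

text \<open>For an eigenvector \<open>x\<close> and \<open>s\<close> the pairing of \<open>w\<close>
  with \<open>x\<close>, row \<open>i\<close> reads \<open>(l - d i) * x $ i = u i * s\<close>. Here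
  \<open>s\<close> is nonzero, as otherwise \<open>x\<close> would vanish; solving for
  \<open>x $ i\<close>, pairing with \<open>w\<close> again and cancelling \<open>s\<close> gives
  the equation.\<close>

lemma eigenvalue_rank_one_plus_diag:
  fixes u w d :: "nat \<Rightarrow> 'a :: field"
  assumes "eigenvalue (mat n n (\<lambda>(i, j). u i * w j + (if i = j then d i else 0))) l"
    and ne: "\<And>i. i < n \<Longrightarrow> l \<noteq> d i"
  shows "(\<Sum>i<n. w i * u i / (l - d i)) = 1"
proof -
  define A where "A = mat n n (\<lambda>(i, j). u i * w j + (if i = j then d i else 0))"
  obtain x where x: "x \<in> carrier_vec n" "x \<noteq> 0\<^sub>v n" "A *\<^sub>v x = l \<cdot>\<^sub>v x"
    using assms(1) unfolding A_def eigenvalue_def eigenvector_def by auto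
  define s where "s = (\<Sum>j<n. w j * x $ j)"
  have x_eq: "x $ i = u i * s / (l - d i)" if i: "i < n" for i
  proof -
    have "l * x $ i = (A *\<^sub>v x) $ i"
      unfolding x(3) using x(1) i by simp
    also have "\<dots> = (\<Sum>j<n. (u i * w j + (if i = j then d i else 0)) * x $ j)"
      using i x(1) by (auto simp: A_def scalar_prod_def lessThan_atLeast0)
    also have "\<dots> = (\<Sum>j<n. u i * (w j * x $ j) + (if j = i then d i * x $ i else 0))"
      by (intro sum.cong) (auto simp: algebra_simps)
    also have "\<dots> = u i * s + d i * x $ i"
      using i by (simp add: sum.distrib sum_distrib_left s_def)
    finally show ?thesis
      using ne[OF i] by (simp add: field_simps)
  qed
  have "s \<noteq> 0"
  proof
    assume "s = 0"
    with x x_eq have "x = 0\<^sub>v n" by (intro eq_vecI) auto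
    with x show False by simp
  qed
  moreover have "s = s * (\<Sum>i<n. w i * u i / (l - d i))"
  proof -
    have "(\<Sum>j<n. w j * x $ j) = (\<Sum>j<n. w j * (u j * s / (l - d j)))"
      by (intro sum.cong) (simp_all add: x_eq)
    then have "s = (\<Sum>j<n. w j * (u j * s / (l - d j)))"
      by (simp only: s_def)
    then show ?thesis by (simp add: sum_distrib_left mult_ac)
  qed
  ultimately show ?thesis by simp
qed

lemma norm_avg_le:
  fixes f :: "nat \<Rightarrow> 'a :: real_normed_field"
  assumes "n > 0" "\<And>i. i < n \<Longrightarrow> norm (f i) \<le> c"
  shows "norm ((\<Sum>i<n. f i) / of_nat n) \<le> c"
proof -
  have "norm (\<Sum>i<n. f i) \<le> of_nat n * c"
    using sum_norm_bound[of "{..<n}" f c] assms(2) by simp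
  with assms(1) show ?thesis by (simp add: norm_divide field_simps)
qed

text \<open>Uses \<open>l / (l - y) = 1 + y / (l - y)\<close> with \<open>y\<close> the diagonal
  entry; the ones average to 1 against the weights \<open>m\<close>.\<close>

lemma secular_fixed_point:
  fixes m d :: "nat \<Rightarrow> complex"
  assumes n: "n > 0" and m_avg: "(\<Sum>i<n. m i) = of_nat n"
    and ne: "\<And>i. i < n \<Longrightarrow> l \<noteq> of_real \<epsilon> * d i"
    and sec: "(\<Sum>i<n. m i / (l - of_real \<epsilon> * d i)) = of_nat n"
  shows "l = 1 + of_real \<epsilon> * ((\<Sum>i<n. m i * d i / (l - of_real \<epsilon> * d i)) / of_nat n)"
proof -
  have "l * of_nat n = (\<Sum>i<n. l * (m i / (l - of_real \<epsilon> * d i)))"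
    unfolding sum_distrib_left[symmetric] sec ..
  also have "\<dots> = (\<Sum>i<n. m i + of_real \<epsilon> * (m i * d i / (l - of_real \<epsilon> * d i)))"
    using ne by (intro sum.cong) (auto simp: field_simps)
  also have "\<dots> = of_nat n + of_real \<epsilon> * (\<Sum>i<n. m i * d i / (l - of_real \<epsilon> * d i))"
    by (simp add: sum.distrib m_avg sum_distrib_left)
  finally show ?thesis
    using n by (simp add: field_simps)
qed

text \<open>If \<open>l\<close> is large compared with the diagonal entries, all denominators are at
  least half of its modulus. The fixed point equation then bounds the product of the distances of
  \<open>l\<close> to 0 and to 1 by a multiple of \<epsilon>, so one of the two distances is
  small.\<close>

lemma secular_dichotomy:
  fixes m d :: "nat \<Rightarrow> complex"
  assumes n: "n > 0" and \<epsilon>: "\<epsilon> > 0" and B: "B \<ge> 1"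
    and m: "\<And>i. i < n \<Longrightarrow> norm (m i) \<le> B" and d: "\<And>i. i < n \<Longrightarrow> norm (d i) \<le> \<Delta>"
    and fp: "l = 1 + of_real \<epsilon> * ((\<Sum>i<n. m i * d i / (l - of_real \<epsilon> * d i)) / of_nat n)"
    and large: "norm l > 4 * B * \<Delta> * \<epsilon>"
  shows "norm (l - 1) \<le> 4 * B * \<Delta> * \<epsilon>"
proof -
  have \<Delta>: "\<Delta> \<ge> 0" using d[OF n] norm_ge_zero[of "d 0"] by linarith
  have lpos: "norm l > 0"
    using large \<Delta> \<epsilon> B by (smt (verit) mult_nonneg_nonneg)
  have "2 * (\<Delta> * \<epsilon>) \<le> (4 * B) * (\<Delta> * \<epsilon>)"
    using \<Delta> \<epsilon> B by (intro mult_right_mono) auto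
  then have half: "2 * (\<epsilon> * \<Delta>) \<le> norm l"
    using large by (simp add: mult_ac)
  have den: "norm l / 2 \<le> norm (l - of_real \<epsilon> * d i)" if "i < n" for i
  proof -
    have "norm (of_real \<epsilon> * d i) \<le> \<epsilon> * \<Delta>"
      using d[OF that] \<epsilon> by (simp add: norm_mult)
    with half norm_triangle_ineq2[of l "of_real \<epsilon> * d i"] show ?thesis by linarith
  qed
  have "norm (m i * d i / (l - of_real \<epsilon> * d i)) \<le> B * \<Delta> / (norm l / 2)" if "i < n" for i
    unfolding norm_divide norm_mult
    using m[OF that] d[OF that] den[OF that] B \<Delta> lpos
    by (intro frac_le mult_mono) auto
  then have "norm ((\<Sum>i<n. m i * d i / (l - of_real \<epsilon> * d i)) / of_nat n) \<le> B * \<Delta> / (norm l / 2)"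
    (is "norm ?S \<le> _")
    by (rule norm_avg_le[OF n])
  moreover have "l - 1 = of_real \<epsilon> * ?S"
    using fp by (metis add_diff_cancel_left')
  ultimately have "norm (l - 1) \<le> \<epsilon> * (B * \<Delta> / (norm l / 2))"
    using \<epsilon> by (simp only: norm_mult norm_of_real abs_of_pos mult_left_mono less_imp_le)
  then have bound: "norm (l - 1) * norm l \<le> 2 * B * \<Delta> * \<epsilon>"
    using lpos by (simp add: field_simps)
  \<comment> \<open>Otherwise \<open>bound\<close> would give
    \<open>norm l / 2 \<le> 2 * B * \<Delta> * \<epsilon>\<close>, contradicting
    \<open>large\<close>.\<close>
  have "norm (l - 1) \<le> 1 / 2"
  proof (rule ccontr)
    assume "\<not> norm (l - 1) \<le> 1 / 2"
    then have "norm l / 2 \<le> norm (l - 1) * norm l"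
      using lpos by (simp add: field_simps)
    with bound large show False by simp
  qed
  \<comment> \<open>Cancelling \<open>norm l\<close> from \<open>bound\<close> costs a factor 2,
    which is how the constant 4 arises.\<close>
  then have "norm l \<ge> 1 / 2"
    using norm_triangle_ineq2[of 1 "1 - l"] by (simp add: norm_minus_commute)
  then have "norm (l - 1) * (1 / 2) \<le> norm (l - 1) * norm l"
    by (intro mult_left_mono) auto
  with bound show ?thesis by simp
qed

text \<open>Near \<open>l = 1\<close> each denominator \<open>y\<close> is close to 1, and
  \<open>1 / y = (2 - y) + (y - 1)\<^sup>2 / y\<close> is its first order expansion with exact
  remainder. Averaging yields an equation for \<open>w = l - 1\<close>, which is then substituted
  once into itself.\<close>

lemma secular_expansion:
  fixes m d :: "nat \<Rightarrow> complex" and \<epsilon> K B \<Delta> :: real and n :: nat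
  defines "a \<equiv> (\<Sum>i<n. m i * d i) / of_nat n"
    and "b \<equiv> (\<Sum>i<n. m i * (d i)\<^sup>2) / of_nat n"
  assumes n: "n > 0" and \<epsilon>: "\<epsilon> > 0" "\<epsilon> \<le> 1" and B: "B \<ge> 1"
    and m: "\<And>i. i < n \<Longrightarrow> norm (m i) \<le> B" and d: "\<And>i. i < n \<Longrightarrow> norm (d i) \<le> \<Delta>"
    and fp: "l = 1 + of_real \<epsilon> * ((\<Sum>i<n. m i * d i / (l - of_real \<epsilon> * d i)) / of_nat n)"
    and near: "norm (l - 1) \<le> K * \<epsilon>"
    and small: "(K + \<Delta>) * \<epsilon> \<le> 1 / 2"
  shows "norm (l - (1 + of_real \<epsilon> * a + (of_real \<epsilon>)\<^sup>2 * (b - a\<^sup>2)))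
           \<le> ((B * \<Delta>)\<^sup>2 * K + B * \<Delta> * (B * \<Delta>\<^sup>2) + (1 + B * \<Delta>) * (2 * (B * \<Delta> * (K + \<Delta>)\<^sup>2))) * \<epsilon> ^ 3"
proof -
  define w where "w = l - 1"
  \<comment> \<open>The quadratic remainder: \<open>w - of_real \<epsilon> * d i\<close> is
    \<open>y - 1\<close> for the denominator \<open>y\<close>.\<close>
  define r where "r i = m i * d i * (w - of_real \<epsilon> * d i)\<^sup>2 / (l - of_real \<epsilon> * d i)" for i
  define R where "R = (\<Sum>i<n. r i) / of_nat n"
  have \<Delta>: "\<Delta> \<ge> 0" using d[OF n] norm_ge_zero[of "d 0"] by linarith
  have K: "K \<ge> 0" using order_trans[OF norm_ge_zero near] \<epsilon> by (simp add: zero_le_mult_iff)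
  have wd: "norm (w - of_real \<epsilon> * d i) \<le> (K + \<Delta>) * \<epsilon>" if "i < n" for i
  proof -
    have "norm (of_real \<epsilon> * d i) \<le> \<epsilon> * \<Delta>"
      using d[OF that] \<epsilon> by (simp add: norm_mult)
    then show ?thesis
      using near norm_triangle_ineq4[of w "of_real \<epsilon> * d i"] by (simp add: w_def algebra_simps)
  qed
  have den: "norm (l - of_real \<epsilon> * d i) \<ge> 1 / 2" if "i < n" for i
    using wd[OF that] small norm_triangle_ineq2[of 1 "- (w - of_real \<epsilon> * d i)"]
    by (simp add: w_def norm_minus_commute algebra_simps)
  have R: "norm R \<le> 2 * (B * \<Delta> * (K + \<Delta>)\<^sup>2) * \<epsilon>\<^sup>2"
    unfolding R_def
  proof (rule norm_avg_le[OF n])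
    fix i assume i: "i < n"
    have "norm (r i) \<le> B * \<Delta> * ((K + \<Delta>) * \<epsilon>)\<^sup>2 / (1 / 2)"
      unfolding r_def norm_divide norm_mult norm_power
      using m[OF i] d[OF i] den[OF i] wd[OF i] B \<Delta>
      by (intro frac_le mult_mono power_mono) auto
    then show "norm (r i) \<le> 2 * (B * \<Delta> * (K + \<Delta>)\<^sup>2) * \<epsilon>\<^sup>2"
      by (simp add: power_mult_distrib mult_ac)
  qed
  have a: "norm a \<le> B * \<Delta>"
    unfolding a_def using m d B \<Delta>
    by (intro norm_avg_le[OF n]) (auto simp: norm_mult intro!: mult_mono)
  have b: "norm b \<le> B * \<Delta>\<^sup>2"
    unfolding b_def using m d B \<Delta>
    by (intro norm_avg_le[OF n]) (auto simp: norm_mult norm_power intro!: mult_mono power_mono)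
  have term_eq: "m i * d i / (l - of_real \<epsilon> * d i)
      = (1 - w) * (m i * d i) + of_real \<epsilon> * (m i * (d i)\<^sup>2) + r i" if "i < n" for i
  proof -
    define y where "y = l - of_real \<epsilon> * d i"
    have y: "y \<noteq> 0" using den[OF that] by (auto simp: y_def)
    \<comment> \<open>This is \<open>1 = (2 - y) * y + (y - 1)\<^sup>2\<close>, multiplied by
      \<open>m i * d i\<close>.\<close>
    have "m i * d i = m i * d i * (2 - y) * y + m i * d i * (y - 1)\<^sup>2"
      by (simp add: power2_eq_square algebra_simps)
    then have "m i * d i / y = (m i * d i * (2 - y) * y + m i * d i * (y - 1)\<^sup>2) / y"
      by (rule arg_cong)
    also have "\<dots> = m i * d i * (2 - y) + m i * d i * (y - 1)\<^sup>2 / y"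
      using y by (simp add: add_divide_distrib)
    finally have "m i * d i / y = \<dots>" .
    moreover have "w - of_real \<epsilon> * d i = y - 1" by (simp add: w_def y_def)
    moreover have "(1 - w) * (m i * d i) + of_real \<epsilon> * (m i * (d i)\<^sup>2) = m i * d i * (2 - y)"
      by (simp add: w_def y_def algebra_simps power2_eq_square)
    ultimately show ?thesis
      unfolding r_def y_def[symmetric] by (simp only:)
  qed
  have "(\<Sum>i<n. m i * d i / (l - of_real \<epsilon> * d i)) / of_nat n = (1 - w) * a + of_real \<epsilon> * b + R"
    by (simp add: term_eq a_def b_def R_def sum.distrib add_divide_distrib flip: sum_distrib_left)
  with fp have w: "w = of_real \<epsilon> * ((1 - w) * a + of_real \<epsilon> * b + R)"
    unfolding w_def by (metis add_diff_cancel_left')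
  let ?main = "1 + of_real \<epsilon> * a + (of_real \<epsilon>)\<^sup>2 * (b - a\<^sup>2)"
  \<comment> \<open>Substituting equation \<open>w\<close> into itself is recorded as a polynomial
    identity: the discrepancy is \<open>1 - of_real \<epsilon> * a\<close> times the defect of that
    equation. Each of the three error terms is of third order, since \<open>w\<close> is of first
    and \<open>R\<close> of second order in \<epsilon>.\<close>
  have "l - ?main - ((of_real \<epsilon>)\<^sup>2 * a\<^sup>2 * w - (of_real \<epsilon>) ^ 3 * (a * b)
        + of_real \<epsilon> * ((1 - of_real \<epsilon> * a) * R))
      = (1 - of_real \<epsilon> * a) * (w - of_real \<epsilon> * ((1 - w) * a + of_real \<epsilon> * b + R))"
    by (simp add: w_def power2_eq_square power3_eq_cube algebra_simps)
  also have "\<dots> = 0"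
    using w by simp
  finally have eq: "l - ?main = (of_real \<epsilon>)\<^sup>2 * a\<^sup>2 * w - (of_real \<epsilon>) ^ 3 * (a * b)
      + of_real \<epsilon> * ((1 - of_real \<epsilon> * a) * R)"
    by simp
  have "norm ((of_real \<epsilon>)\<^sup>2 * a\<^sup>2 * w) \<le> \<epsilon>\<^sup>2 * (B * \<Delta>)\<^sup>2 * (K * \<epsilon>)"
    unfolding norm_mult norm_power using a near \<epsilon> B \<Delta>
    by (intro mult_mono power_mono) (auto simp: w_def)
  moreover have "norm ((of_real \<epsilon>) ^ 3 * (a * b)) \<le> \<epsilon> ^ 3 * (B * \<Delta> * (B * \<Delta>\<^sup>2))"
    unfolding norm_mult norm_power using a b \<epsilon> B \<Delta>
    by (intro mult_mono power_mono) auto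
  moreover have "norm (of_real \<epsilon> * ((1 - of_real \<epsilon> * a) * R))
      \<le> \<epsilon> * ((1 + B * \<Delta>) * (2 * (B * \<Delta> * (K + \<Delta>)\<^sup>2) * \<epsilon>\<^sup>2))"
  proof -
    have "norm (of_real \<epsilon> * a) \<le> 1 * (B * \<Delta>)"
      unfolding norm_mult using a \<epsilon> B \<Delta> by (intro mult_mono) auto
    then have "norm (1 - of_real \<epsilon> * a) \<le> 1 + B * \<Delta>"
      using norm_triangle_ineq4[of 1 "of_real \<epsilon> * a"] by simp
    then show ?thesis
      unfolding norm_mult using R \<epsilon> B \<Delta> by (intro mult_mono) auto
  qed
  moreover have "norm (x - y + z) \<le> norm x + norm y + norm z" for x y z :: complex
    using norm_triangle_ineq[of "x - y" z] norm_triangle_ineq4[of x y] by linarith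
  ultimately have "norm (l - ?main) \<le> \<epsilon>\<^sup>2 * (B * \<Delta>)\<^sup>2 * (K * \<epsilon>) + \<epsilon> ^ 3 * (B * \<Delta> * (B * \<Delta>\<^sup>2))
      + \<epsilon> * ((1 + B * \<Delta>) * (2 * (B * \<Delta> * (K + \<Delta>)\<^sup>2) * \<epsilon>\<^sup>2))"
    unfolding eq by (meson add_mono order_trans)
  also have "\<dots> = ((B * \<Delta>)\<^sup>2 * K + B * \<Delta> * (B * \<Delta>\<^sup>2) + (1 + B * \<Delta>) * (2 * (B * \<Delta> * (K + \<Delta>)\<^sup>2))) * \<epsilon> ^ 3"
    by (simp add: power3_eq_cube power2_eq_square[of \<epsilon>] algebra_simps)
  finally show ?thesis .
qed

section \<open>Localisation of the spectrum and simplicity of the dominant eigenvalue\<close>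

text \<open>
  All eigenvalues lie within \<open>4 B \<Delta> \<epsilon>\<close> of \<open>0\<close> or of \<open>1\<close>. As the trace is close to \<open>1\<close>, exactly one
  of them, counted with multiplicity, is of the second kind.
\<close>

lemma rank_one_plus_small_diag_spectrum:
  fixes m d :: "nat \<Rightarrow> complex" and \<epsilon> B \<Delta> :: real and n :: nat
  defines "A \<equiv> mat n n (\<lambda>(i, j). m i * (1 / of_nat n) + (if i = j then of_real \<epsilon> * d i else 0))"
  assumes n: "n > 0" and \<epsilon>: "\<epsilon> > 0" and B: "B \<ge> 1"
    and m_avg: "(\<Sum>i<n. m i) = of_nat n"
    and m: "\<And>i. i < n \<Longrightarrow> norm (m i) \<le> B" and d: "\<And>i. i < n \<Longrightarrow> norm (d i) \<le> \<Delta>"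
    and small: "2 * real n * (4 * B * \<Delta> * \<epsilon>) < 1"
  shows "\<exists>l. spectrum A \<subseteq> cball 0 (4 * B * \<Delta> * \<epsilon>) \<union> {l} \<and>
    simple_eigenvalue A l \<and> dominant_eigenvalue A l \<and> norm (l - 1) \<le> 4 * B * \<Delta> * \<epsilon> \<and>
    l = 1 + of_real \<epsilon> * ((\<Sum>i<n. m i * d i / (l - of_real \<epsilon> * d i)) / of_nat n)"
proof -
  define \<kappa> where "\<kappa> = 4 * B * \<Delta> * \<epsilon>"
  have A: "A \<in> carrier_mat n n" by (simp add: A_def)
  have \<Delta>: "\<Delta> \<ge> 0" using d[OF n] norm_ge_zero[of "d 0"] by linarith
  have \<kappa>0: "\<kappa> \<ge> 0" using B \<Delta> \<epsilon> by (simp add: \<kappa>_def)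
  have n\<kappa>: "real n * \<kappa> < 1 / 2" using small by (simp add: \<kappa>_def)
  have "1 * \<kappa> \<le> real n * \<kappa>" using n \<kappa>0 by (intro mult_right_mono) auto
  with n\<kappa> have \<kappa>: "\<kappa> < 1 / 2" by simp
  \<comment> \<open>As \<open>B \<ge> 1\<close>, the entries of the small diagonal stay in the disc
    of radius \<open>\<kappa> / 4\<close>. This separates them from any eigenvalue of modulus above
    \<kappa> and also controls the trace.\<close>
  have "1 * (\<Delta> * \<epsilon>) \<le> B * (\<Delta> * \<epsilon>)" using B \<Delta> \<epsilon> by (intro mult_right_mono) auto
  then have \<Delta>\<epsilon>: "\<epsilon> * \<Delta> \<le> \<kappa> / 4" by (simp add: \<kappa>_def mult_ac)
  have \<epsilon>d: "norm (of_real \<epsilon> * d i) \<le> \<kappa> / 4" if "i < n" for i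
  proof -
    have "norm (of_real \<epsilon> * d i) \<le> \<epsilon> * \<Delta>"
      using d[OF that] \<epsilon> by (simp add: norm_mult)
    with \<Delta>\<epsilon> show ?thesis by simp
  qed
  have fixed_point: "l = 1 + of_real \<epsilon> * ((\<Sum>i<n. m i * d i / (l - of_real \<epsilon> * d i)) / of_nat n)"
    if l: "eigenvalue A l" "norm l > \<kappa>" for l
  proof -
    have ne: "l \<noteq> of_real \<epsilon> * d i" if "i < n" for i
      using l(2) \<epsilon>d[OF that] \<kappa>0 by auto
    have "(\<Sum>i<n. 1 / of_nat n * m i / (l - of_real \<epsilon> * d i)) = 1"
      using l(1) ne unfolding A_def by (intro eigenvalue_rank_one_plus_diag) auto
    then have "(\<Sum>i<n. m i / (l - of_real \<epsilon> * d i)) / of_nat n = 1"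
      by (simp add: sum_divide_distrib mult.commute)
    then show ?thesis
      using n ne m_avg by (intro secular_fixed_point) (auto simp: field_simps)
  qed
  have dichotomy: "norm l \<le> \<kappa> \<or> norm (l - 1) \<le> \<kappa>" if "eigenvalue A l" for l
    using secular_dichotomy[OF n \<epsilon> B m d fixed_point[OF that]]
    unfolding \<kappa>_def by fastforce
  have near_one: "norm l > 1 / 2" if "norm (l - 1) \<le> \<kappa>" for l :: complex
    using that \<kappa> norm_triangle_ineq2[of 1 "1 - l"] by (simp add: norm_minus_commute)
  obtain es where es: "char_poly A = (\<Prod>e\<leftarrow>es. [:- e, 1:])" and len: "length es = n"
    using char_poly_factorized[OF A] by auto
  have ev_iff: "eigenvalue A l \<longleftrightarrow> l \<in> set es" for l
    unfolding eigenvalue_root_char_poly[OF A] es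
    by (auto simp: poly_prod_list prod_list_zero_iff)
  define near where "near = filter (\<lambda>e. norm (e - 1) \<le> \<kappa>) es"
  \<comment> \<open>Rounding each eigenvalue to 1 if it is counted in \<open>near\<close>, and to 0
    otherwise, moves it by at most \<kappa>. The list is generalised to \<open>xs\<close> for the
    induction, while \<open>es\<close> stays fixed in the dichotomy.\<close>
  have "norm (sum_list xs - of_nat (length (filter (\<lambda>e. norm (e - 1) \<le> \<kappa>) xs)))
      \<le> real (length xs) * \<kappa>" if "set xs \<subseteq> set es" for xs
    using that
  proof (induction xs)
    case (Cons x xs)
    let ?s = "sum_list xs - of_nat (length (filter (\<lambda>e. norm (e - 1) \<le> \<kappa>) xs))"
    have "norm x \<le> \<kappa> \<or> norm (x - 1) \<le> \<kappa>"
      using Cons.prems dichotomy ev_iff by auto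
    moreover have "norm ?s \<le> real (length xs) * \<kappa>"
      using Cons by auto
    moreover have "x + sum_list xs - of_nat (length (filter (\<lambda>e. norm (e - 1) \<le> \<kappa>) xs)) = x + ?s"
      "x + sum_list xs - (1 + of_nat (length (filter (\<lambda>e. norm (e - 1) \<le> \<kappa>) xs))) = (x - 1) + ?s"
      by simp_all
    ultimately show ?case
      using norm_triangle_ineq[of x ?s] norm_triangle_ineq[of "x - 1" ?s]
      by (auto simp: algebra_simps)
  qed simp
  from this[of es] have 1: "norm (sum_list es - of_nat (length near)) \<le> real n * \<kappa>"
    by (simp add: near_def len)
  \<comment> \<open>The trace read off the matrix entries: the rank one part contributes exactly 1
    by \<open>m_avg\<close>.\<close>
  have "sum_list es = (\<Sum>i<n. A $$ (i, i))"
    using sum_diag_eq_sum_list_eigenvalues[OF A es] by simp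
  also have "\<dots> = 1 + (\<Sum>i<n. of_real \<epsilon> * d i)"
    using n m_avg by (simp add: A_def sum.distrib flip: sum_divide_distrib)
  finally have 2: "norm (sum_list es - 1) \<le> real n * (\<kappa> / 4)"
    using sum_norm_bound[of "{..<n}" "\<lambda>i. of_real \<epsilon> * d i" "\<kappa> / 4"] \<epsilon>d by simp
  \<comment> \<open>The two estimates add up to at most \<open>5 / 4 * (real n * \<kappa>)\<close>,
    which is below \<open>5 / 8\<close>; so the integer \<open>length near\<close> must be
    1.\<close>
  have "norm (of_nat (length near) - 1 :: complex) < 1"
    using 1 2 n\<kappa> norm_triangle_ineq4[of "sum_list es - 1" "sum_list es - of_nat (length near)"]
    by (simp add: algebra_simps)
  then have "\<bar>real (length near) - 1\<bar> < 1"
    by (metis norm_of_real of_real_1 of_real_diff of_real_of_nat_eq)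
  then have "length near = 1" by linarith
  then obtain l where l: "near = [l]"
    by (cases near) auto
  then have "l \<in> set near" by simp
  then have mem: "l \<in> set es" "norm (l - 1) \<le> \<kappa>"
    by (auto simp: near_def)
  have uniq: "x = l" if "x \<in> set es" "norm (x - 1) \<le> \<kappa>" for x
  proof -
    have "x \<in> set near" using that by (simp add: near_def)
    with l show ?thesis by simp
  qed
  \<comment> \<open>Every copy of \<open>l\<close> in \<open>es\<close> survives in
    \<open>near\<close>, so the one-element list \<open>near\<close> gives the full multiplicity of
    \<open>l\<close>.\<close>
  have "filter ((=) l) es = filter ((=) l) near"
    unfolding near_def filter_filter using mem by (intro filter_cong) auto
  then have "count_list es l = 1"
    using l by (simp add: count_list_eq_length_filter)
  then have "simple_eigenvalue A l"
    unfolding simple_eigenvalue_def using mem ev_iff es by (simp add: order_prod_list_linear)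
  moreover have sub: "spectrum A \<subseteq> cball 0 \<kappa> \<union> {l}"
  proof
    fix x assume "x \<in> spectrum A"
    then have "eigenvalue A x" by (simp add: spectrum_def)
    then show "x \<in> cball 0 \<kappa> \<union> {l}"
      using dichotomy[of x] uniq[of x] ev_iff[of x] by auto
  qed
  moreover have "dominant_eigenvalue A l"
    unfolding dominant_eigenvalue_def
  proof (intro conjI ballI)
    show "eigenvalue A l" using mem ev_iff by simp
    fix x assume "x \<in> spectrum A - {l}"
    with sub have "norm x \<le> \<kappa>" by auto
    with near_one[OF mem(2)] \<kappa> show "norm x < norm l" by simp
  qed
  moreover have "l = 1 + of_real \<epsilon> * ((\<Sum>i<n. m i * d i / (l - of_real \<epsilon> * d i)) / of_nat n)"
    by (rule fixed_point) (use mem ev_iff near_one[OF mem(2)] \<kappa> in auto)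
  ultimately show ?thesis
    using mem(2) unfolding \<kappa>_def by (intro exI[of _ l] conjI)
qed

section \<open>The concrete matrix and averages over symmetric velocities\<close>

text \<open>All entries of \<open>P_mat J\<close> equal \<open>1 / J\<close>, so the diagonal matrix
  \<open>M_mat\<close> only scales its rows.\<close>

lemma A_mat_rank_one_plus_diag:
  "A_mat J \<gamma> v \<alpha> \<beta> \<epsilon> = mat J J (\<lambda>(i, j). of_real (1 + \<epsilon> ^ \<gamma> / v (Suc i)) * (1 / of_nat J)
     + (if i = j then of_real \<epsilon> * Complex (\<alpha> (Suc i)) (\<beta> (Suc i)) else 0))"
proof -
  have P: "P_mat J = mat J J (\<lambda>_. 1 / of_nat J)"
    by (rule eq_matI)
      (auto simp: P_mat_def e_col_def scalar_prod_def simp flip: of_real_mult real_sqrt_mult)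
  have M: "M_mat J \<gamma> v \<epsilon> = mat_diag J (\<lambda>i. of_real (1 + \<epsilon> ^ \<gamma> / v (Suc i)))"
    by (rule eq_matI) (auto simp: M_mat_def V_inv_def diag_of_def mat_diag_def)
  have "M_mat J \<gamma> v \<epsilon> * P_mat J = mat J J (\<lambda>(i, j). of_real (1 + \<epsilon> ^ \<gamma> / v (Suc i)) * (1 / of_nat J))"
    unfolding M P by (subst mat_diag_mult_left[of _ J J]) (auto intro!: eq_matI)
  then show ?thesis
    by (auto simp: A_mat_def D_mat_def diag_of_def mat_diag_def intro!: eq_matI)
qed

lemma avg_cong: "(\<And>j. j \<in> {1..J} \<Longrightarrow> f j = g j) \<Longrightarrow> avg J f = avg J g"
  unfolding avg_def by (metis (mono_tags, lifting) sum.cong)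

lemma avg_linear:
  shows "avg J (\<lambda>j. f j + g j) = avg J f + avg J g"
    and "avg J (\<lambda>j. f j - g j) = avg J f - avg J g"
    and "avg J (\<lambda>j. c * f j) = c * avg J f"
  by (simp_all add: avg_def sum.distrib sum_subtractf add_divide_distrib diff_divide_distrib
      flip: sum_distrib_left)

lemma avg_const: "J > 0 \<Longrightarrow> avg J (\<lambda>_. c) = c"
  by (simp add: avg_def)

text \<open>Reversing the order of summation maps the sum to its negative. Reflection of the index
  is the symmetry of the velocities, so this disposes of all averages that are odd in
  \<open>v\<close>.\<close>

lemma avg_odd:
  assumes "\<And>j. j \<in> {1..J} \<Longrightarrow> f (J + 1 - j) = - f j"
  shows "avg J f = 0"
proof -
  have "sum f {1..J} = (\<Sum>j = 1..J. f (J + 1 - j))"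
    by (rule sum.atLeastAtMost_rev)
  also have "\<dots> = - sum f {1..J}"
    using assms by (simp add: sum_negf)
  finally show ?thesis by (simp add: avg_def)
qed

lemma complex_avg:
  "(\<Sum>i<J. Complex (f (Suc i)) (g (Suc i))) / of_nat J = Complex (avg J f) (avg J g)"
proof -
  have "Complex x y / of_nat J = Complex (x / real J) (y / real J)" for x y
    by (cases "J = 0") (auto simp: complex_eq_iff Re_divide_of_nat Im_divide_of_nat)
  then show ?thesis
    by (simp add: avg_def complex_eq_iff sum.atLeast1_atMost_eq)
qed

lemma smallo_square_if_cube_bound:
  fixes f :: "real \<Rightarrow> real"
  assumes "\<forall>\<^sub>F \<epsilon> in at_right 0. \<bar>f \<epsilon>\<bar> \<le> K * \<epsilon> ^ 3"
  shows "f \<in> o[at_right 0](\<lambda>\<epsilon>. \<epsilon>\<^sup>2)"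
proof (rule landau_o.smallI)
  fix c :: real assume c: "c > 0"
  \<comment> \<open>Dividing by \<open>\<bar>K\<bar> + 1\<close> rather than \<open>K\<close> covers
    constants \<open>K\<close> that are zero or negative.\<close>
  have "\<forall>\<^sub>F \<epsilon> in at_right 0. \<epsilon> \<in> {0 <..< c / (\<bar>K\<bar> + 1)}"
    using c by (intro eventually_at_right_real) auto
  with assms show "\<forall>\<^sub>F \<epsilon> in at_right 0. norm (f \<epsilon>) \<le> c * norm (\<epsilon>\<^sup>2)"
  proof eventually_elim
    case (elim \<epsilon>)
    then have "K * \<epsilon> \<le> (\<bar>K\<bar> + 1) * \<epsilon>"
      by (intro mult_right_mono) auto
    moreover have "(\<bar>K\<bar> + 1) * \<epsilon> \<le> c"
      using elim by (simp add: field_simps)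
    ultimately have "K * \<epsilon> * \<epsilon>\<^sup>2 \<le> c * \<epsilon>\<^sup>2"
      by (intro mult_right_mono) auto
    moreover have "K * \<epsilon> ^ 3 = K * \<epsilon> * \<epsilon>\<^sup>2"
      by (simp add: power3_eq_cube power2_eq_square)
    ultimately have "\<bar>f \<epsilon>\<bar> \<le> c * \<epsilon>\<^sup>2" using elim by linarith
    then show ?case by simp
  qed
qed

section \<open>Assembly for the two schemes and both scalings\<close>

theorem theorem4p1:
  fixes J :: nat and v \<alpha> \<beta> :: "nat \<Rightarrow> real" and \<zeta> dx :: real
  assumes "even J" and "J > 0"
    and distinct: "inj_on v {1..J}"
    and nonzero: "\<forall>j\<in>{1..J}. v j \<noteq> 0"
    and symmetric: "\<forall>j\<in>{1..J div 2}. v (J + 1 - j) = - v j"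
    and positive: "{j\<in>{1..J}. v j > 0} = {J div 2 + 1..J}"
    and "dx > 0"
    and scheme: "upwind3 J v \<zeta> dx \<alpha> \<beta> \<or> central4 J v \<zeta> dx \<alpha> \<beta>"
  shows "\<exists>C>0. \<forall>\<gamma>\<in>{0, 1}.
    (\<forall>\<^sub>F \<epsilon> in at_right 0. invertible_mat (M_mat J \<gamma> v \<epsilon>)) \<longrightarrow>
    (\<exists>ev :: real \<Rightarrow> complex.
      (\<forall>\<^sub>F \<epsilon> in at_right 0.
        spectrum (A_mat J \<gamma> v \<alpha> \<beta> \<epsilon>)
          \<subseteq> cball 0 (\<epsilon> * C * Max ((\<lambda>j. \<bar>\<alpha> j\<bar> + \<bar>\<beta> j\<bar>) ` {J div 2 + 1..J})) \<union> {ev \<epsilon>} \<and>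
        simple_eigenvalue (A_mat J \<gamma> v \<alpha> \<beta> \<epsilon>) (ev \<epsilon>) \<and>
        dominant_eigenvalue (A_mat J \<gamma> v \<alpha> \<beta> \<epsilon>) (ev \<epsilon>)) \<and>
      (\<lambda>\<epsilon>. Re (ev \<epsilon>) -
        (1 + \<epsilon> * avg J \<alpha>
           + \<epsilon>\<^sup>2 * (avg J (\<lambda>j. (avg J \<alpha> - \<alpha> j)\<^sup>2) - avg J (\<lambda>j. (\<beta> j)\<^sup>2)
                   + of_bool (\<gamma> = 0) * (avg J (\<lambda>j. \<beta> j / v j))\<^sup>2)))
        \<in> o[at_right 0](\<lambda>\<epsilon>. \<epsilon>\<^sup>2) \<and>
      (\<lambda>\<epsilon>. Im (ev \<epsilon>) -
        (\<epsilon> * of_bool (\<gamma> = 0) * avg J (\<lambda>j. \<beta> j / v j)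
           + \<epsilon>\<^sup>2 * (of_bool (\<gamma> = 0)
                     * avg J (\<lambda>j. (avg J (\<lambda>k. \<beta> k / v k) - \<beta> j) * (avg J \<alpha> - \<alpha> j))
                   + of_bool (\<gamma> = 1) * avg J (\<lambda>j. \<beta> j / v j))))
        \<in> o[at_right 0](\<lambda>\<epsilon>. \<epsilon>\<^sup>2))"
proof -
  obtain p q where pq: "\<And>j. j \<in> {1..J} \<Longrightarrow> \<alpha> j = p * \<bar>v j\<bar>" "\<And>j. j \<in> {1..J} \<Longrightarrow> \<beta> j = q * v j"
  proof (cases "upwind3 J v \<zeta> dx \<alpha> \<beta>")
    case True
    then show ?thesis
      by (intro that[of "- (3 - 4 * cos \<zeta> + cos (2 * \<zeta>)) / (6 * dx)"
            "- (8 * sin \<zeta> - sin (2 * \<zeta>)) / (6 * dx)"]) (auto simp: upwind3_def algebra_simps diff_divide_distrib add_divide_distrib)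
  next
    case False
    with scheme show ?thesis
      by (intro that[of 0 "- (8 * sin \<zeta> - sin (2 * \<zeta>)) / (6 * dx)"]) (auto simp: central4_def algebra_simps diff_divide_distrib)
  qed
  have v_sym: "v (J + 1 - j) = - v j" if "j \<in> {1..J}" for j
  proof (cases "j \<le> J div 2")
    case True
    with that symmetric show ?thesis by auto
  next
    \<comment> \<open>As \<open>J\<close> is even there is no middle index: the upper half reflects
      into the lower half, where the symmetry is assumed.\<close>
    case False
    with that \<open>even J\<close> have "J + 1 - j \<in> {1..J div 2}"
      by (auto elim!: evenE)
    with symmetric have "v (J + 1 - (J + 1 - j)) = - v (J + 1 - j)" by blast
    moreover have "J + 1 - (J + 1 - j) = j" using that by auto
    ultimately show ?thesis by simp
  qed
  have \<alpha>_sym: "\<alpha> (J + 1 - j) = \<alpha> j" and \<beta>_sym: "\<beta> (J + 1 - j) = - \<beta> j" if "j \<in> {1..J}" for j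
  proof -
    have "J + 1 - j \<in> {1..J}" using that by auto
    with that show "\<alpha> (J + 1 - j) = \<alpha> j" "\<beta> (J + 1 - j) = - \<beta> j"
      using pq v_sym by auto
  qed
  note sym = v_sym \<alpha>_sym \<beta>_sym
  \<comment> \<open>\<alpha> is even and \<beta>, \<open>v\<close> are odd under
    \<open>j \<mapsto> J + 1 - j\<close>, so all six integrands are odd. The third average is what
    makes the diagonal of \<open>M_mat\<close> average to 1.\<close>
  have odd_avg: "avg J \<beta> = 0" "avg J (\<lambda>j. \<alpha> j / v j) = 0" "avg J (\<lambda>j. 1 / v j) = 0"
    "avg J (\<lambda>j. \<alpha> j * \<beta> j) = 0" "avg J (\<lambda>j. (\<alpha> j)\<^sup>2 / v j) = 0" "avg J (\<lambda>j. (\<beta> j)\<^sup>2 / v j) = 0"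
    by (rule avg_odd; use sym in simp)+
  have avg_\<beta>v: "avg J (\<lambda>j. \<beta> j / v j) = q"
    using pq nonzero avg_const[OF \<open>J > 0\<close>, of q] by (subst avg_cong[of J _ "\<lambda>_. q"]) auto
  have avg_\<alpha>\<beta>v: "avg J (\<lambda>j. \<alpha> j * \<beta> j / v j) = q * avg J \<alpha>"
    using pq nonzero unfolding avg_linear(3)[symmetric] by (intro avg_cong) auto
  have re: "avg J (\<lambda>j. (avg J \<alpha> - \<alpha> j)\<^sup>2) = avg J (\<lambda>j. (\<alpha> j)\<^sup>2) - (avg J \<alpha>)\<^sup>2"
  proof -
    have "avg J (\<lambda>j. (avg J \<alpha> - \<alpha> j)\<^sup>2)
        = avg J (\<lambda>j. (avg J \<alpha>)\<^sup>2 - (2 * avg J \<alpha>) * \<alpha> j + (\<alpha> j)\<^sup>2)"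
      by (intro avg_cong) (simp add: power2_diff)
    then show ?thesis
      using \<open>J > 0\<close> by (simp only: avg_linear avg_const) (simp add: power2_eq_square)
  qed
  have im: "avg J (\<lambda>j. (q - \<beta> j) * (avg J \<alpha> - \<alpha> j)) = 0"
  proof -
    have "avg J (\<lambda>j. (q - \<beta> j) * (avg J \<alpha> - \<alpha> j))
        = avg J (\<lambda>j. q * avg J \<alpha> - q * \<alpha> j - avg J \<alpha> * \<beta> j + \<alpha> j * \<beta> j)"
      by (intro avg_cong) (simp add: algebra_simps)
    then show ?thesis
      using \<open>J > 0\<close> by (simp add: avg_linear avg_const odd_avg)
  qed
  define d where "d i = Complex (\<alpha> (Suc i)) (\<beta> (Suc i))" for i
  define m where "m \<gamma> \<epsilon> i = complex_of_real (1 + \<epsilon> ^ \<gamma> / v (Suc i))" for \<gamma> :: nat and \<epsilon> i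
  \<comment> \<open>Bounds the diagonal of \<open>M_mat\<close> for all
    \<open>\<epsilon> \<le> 1\<close> and every exponent \<gamma>, so one constant serves both
    scalings.\<close>
  define B where "B = 1 + (\<Sum>j = 1..J. 1 / \<bar>v j\<bar>)"
  define \<Delta> where "\<Delta> = Max ((\<lambda>j. \<bar>\<alpha> j\<bar> + \<bar>\<beta> j\<bar>) ` {J div 2 + 1..J})"
  define K where "K = 4 * B * \<Delta>"
  define L where "L = (B * \<Delta>)\<^sup>2 * K + B * \<Delta> * (B * \<Delta>\<^sup>2) + (1 + B * \<Delta>) * (2 * (B * \<Delta> * (K + \<Delta>)\<^sup>2))"
  have B: "B \<ge> 1" by (auto simp: B_def intro!: sum_nonneg)
  have m: "norm (m \<gamma> \<epsilon> i) \<le> B" if "0 < \<epsilon>" "\<epsilon> \<le> 1" "i < J" for \<gamma> \<epsilon> i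
  proof -
    have "\<epsilon> ^ \<gamma> / \<bar>v (Suc i)\<bar> \<le> 1 / \<bar>v (Suc i)\<bar>"
      using that by (intro divide_right_mono power_le_one) auto
    also have "\<dots> \<le> (\<Sum>j = 1..J. 1 / \<bar>v j\<bar>)"
      using that by (intro member_le_sum) auto
    finally have "\<bar>\<epsilon> ^ \<gamma> / v (Suc i)\<bar> \<le> (\<Sum>j = 1..J. 1 / \<bar>v j\<bar>)"
      using that by simp
    then show ?thesis
      unfolding m_def B_def norm_of_real by linarith
  qed
  have m_avg: "(\<Sum>i<J. m \<gamma> \<epsilon> i) = of_nat J" for \<gamma> \<epsilon>
  proof -
    have "avg J (\<lambda>j. 1 + \<epsilon> ^ \<gamma> * (1 / v j)) = 1"
      using \<open>J > 0\<close> by (simp only: avg_linear avg_const odd_avg mult_zero_right add_0_right)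
    then have "(\<Sum>i<J. 1 + \<epsilon> ^ \<gamma> / v (Suc i)) = real J"
      using \<open>J > 0\<close> by (simp add: avg_def sum.atLeast1_atMost_eq)
    then show ?thesis
      unfolding m_def by (metis of_real_of_nat_eq of_real_sum)
  qed
  have d: "norm (d i) \<le> \<Delta>" if "i < J" for i
  proof -
    have bound: "\<bar>\<alpha> j\<bar> + \<bar>\<beta> j\<bar> \<le> \<Delta>" if "j \<in> {J div 2 + 1..J}" for j
      using that unfolding \<Delta>_def by (intro Max_ge) auto
    have "\<bar>\<alpha> (Suc i)\<bar> + \<bar>\<beta> (Suc i)\<bar> \<le> \<Delta>"
    proof (cases "Suc i \<in> {J div 2 + 1..J}")
      \<comment> \<open>\<Delta> is a maximum over the positive velocities only; an index of the
        lower half reflects into the upper half with the same moduli of \<alpha> and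
        \<beta>.\<close>
      case False
      then have "J + 1 - Suc i \<in> {J div 2 + 1..J}" using that \<open>even J\<close> by (auto elim!: evenE)
      from bound[OF this] show ?thesis using sym[of "Suc i"] that by simp
    qed (rule bound)
    then show ?thesis
      using cmod_le[of "d i"] by (simp add: d_def)
  qed
  have "\<Delta> \<ge> 0" using d[OF \<open>J > 0\<close>] norm_ge_zero order_trans by blast
  \<comment> \<open>Both \<open>b\<close> and \<open>a\<^sup>2\<close> have imaginary part
    \<open>2 * \<epsilon> ^ \<gamma> * q * avg J \<alpha>\<close>, so the second order coefficient
    is real. Minus the square of the imaginary part of \<open>a\<close> enters the real part of
    \<open>a\<^sup>2\<close>, which produces the term
    \<open>+ (\<epsilon> ^ \<gamma> * q)\<^sup>2\<close>.\<close>
  have expansion: "1 + of_real \<epsilon> * a + (of_real \<epsilon>)\<^sup>2 * (b - a\<^sup>2)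
      = Complex (1 + \<epsilon> * avg J \<alpha> + \<epsilon>\<^sup>2 * (avg J (\<lambda>j. (\<alpha> j)\<^sup>2) - (avg J \<alpha>)\<^sup>2
          - avg J (\<lambda>j. (\<beta> j)\<^sup>2) + (\<epsilon> ^ \<gamma> * q)\<^sup>2)) (\<epsilon> * (\<epsilon> ^ \<gamma> * q))"
    if "a = (\<Sum>i<J. m \<gamma> \<epsilon> i * d i) / of_nat J" "b = (\<Sum>i<J. m \<gamma> \<epsilon> i * (d i)\<^sup>2) / of_nat J"
    for a b \<gamma> \<epsilon>
  proof -
    let ?f = "\<lambda>j. \<alpha> j + \<epsilon> ^ \<gamma> * (\<alpha> j / v j)" and ?g = "\<lambda>j. \<beta> j + \<epsilon> ^ \<gamma> * (\<beta> j / v j)"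
    have "m \<gamma> \<epsilon> i * d i = Complex (?f (Suc i)) (?g (Suc i))" for i
      by (simp add: m_def d_def complex_eq_iff algebra_simps)
    then have "a = Complex (avg J ?f) (avg J ?g)"
      unfolding that(1) by (simp only: complex_avg[of ?f ?g])
    then have a: "a = Complex (avg J \<alpha>) (\<epsilon> ^ \<gamma> * q)"
      by (simp only: avg_linear odd_avg avg_\<beta>v mult_zero_right add_0_left add_0_right)
    let ?h = "\<lambda>j. (\<alpha> j)\<^sup>2 - (\<beta> j)\<^sup>2 + \<epsilon> ^ \<gamma> * ((\<alpha> j)\<^sup>2 / v j - (\<beta> j)\<^sup>2 / v j)"
    let ?k = "\<lambda>j. 2 * (\<alpha> j * \<beta> j) + (2 * \<epsilon> ^ \<gamma>) * (\<alpha> j * \<beta> j / v j)"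
    have "m \<gamma> \<epsilon> i * (d i)\<^sup>2 = Complex (?h (Suc i)) (?k (Suc i))" for i
      by (simp add: m_def d_def complex_eq_iff power2_eq_square algebra_simps diff_divide_distrib)
    then have "b = Complex (avg J ?h) (avg J ?k)"
      unfolding that(2) by (simp only: complex_avg[of ?h ?k])
    then have b: "b = Complex (avg J (\<lambda>j. (\<alpha> j)\<^sup>2) - avg J (\<lambda>j. (\<beta> j)\<^sup>2)) (2 * \<epsilon> ^ \<gamma> * (q * avg J \<alpha>))"
      by (simp only: avg_linear odd_avg avg_\<alpha>\<beta>v diff_self mult_zero_right add_0_left add_0_right)
    show ?thesis
      unfolding a b by (simp add: complex_eq_iff power2_eq_square algebra_simps)
  qed
  show ?thesis
  \<comment> \<open>With this constant the radius is \<open>K * \<epsilon>\<close>, the one obtained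
    from the dichotomy.\<close>
  proof (intro exI[of _ "4 * B"] conjI ballI impI)
    show "4 * B > 0" using B by simp
    fix \<gamma> :: nat assume \<gamma>: "\<gamma> \<in> {0, 1}"
    let ?A = "A_mat J \<gamma> v \<alpha> \<beta>"
    let ?re = "\<lambda>\<epsilon>. 1 + \<epsilon> * avg J \<alpha>
           + \<epsilon>\<^sup>2 * (avg J (\<lambda>j. (avg J \<alpha> - \<alpha> j)\<^sup>2) - avg J (\<lambda>j. (\<beta> j)\<^sup>2)
                   + of_bool (\<gamma> = 0) * (avg J (\<lambda>j. \<beta> j / v j))\<^sup>2)"
    let ?im = "\<lambda>\<epsilon>. \<epsilon> * of_bool (\<gamma> = 0) * avg J (\<lambda>j. \<beta> j / v j)
           + \<epsilon>\<^sup>2 * (of_bool (\<gamma> = 0)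
                     * avg J (\<lambda>j. (avg J (\<lambda>k. \<beta> k / v k) - \<beta> j) * (avg J \<alpha> - \<alpha> j))
                   + of_bool (\<gamma> = 1) * avg J (\<lambda>j. \<beta> j / v j))"
    let ?Q = "\<lambda>\<epsilon> l. (spectrum (?A \<epsilon>) \<subseteq> cball 0 (\<epsilon> * (4 * B) * \<Delta>) \<union> {l} \<and>
        simple_eigenvalue (?A \<epsilon>) l \<and> dominant_eigenvalue (?A \<epsilon>) l) \<and>
        \<bar>Re l - ?re \<epsilon>\<bar> \<le> (L + q\<^sup>2) * \<epsilon> ^ 3 \<and> \<bar>Im l - ?im \<epsilon>\<bar> \<le> (L + q\<^sup>2) * \<epsilon> ^ 3"
    \<comment> \<open>Chosen to give \<open>\<epsilon> \<le> 1\<close> and both smallness conditions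
      of \<open>small\<close>; the summand 1 keeps the denominator positive when \<open>K\<close>
      and \<Delta> vanish.\<close>
    define \<delta> where "\<delta> = min 1 (1 / (2 * (real J * K + K + \<Delta> + 1)))"
    have "K \<ge> 0" using B \<open>\<Delta> \<ge> 0\<close> by (simp add: K_def)
    have den: "real J * K + K + \<Delta> + 1 > 0"
      using \<open>K \<ge> 0\<close> \<open>\<Delta> \<ge> 0\<close> by (smt (verit) mult_nonneg_nonneg of_nat_0_le_iff)
    have ex: "\<exists>l. ?Q \<epsilon> l" if \<epsilon>: "\<epsilon> \<in> {0<..<\<delta>}" for \<epsilon>
    proof -
      have \<epsilon>1: "0 < \<epsilon>" "\<epsilon> \<le> 1" using \<epsilon> by (auto simp: \<delta>_def)
      have "\<epsilon> < 1 / (2 * (real J * K + K + \<Delta> + 1))" using \<epsilon> by (simp add: \<delta>_def)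
      then have "\<epsilon> * (2 * (real J * K + K + \<Delta> + 1)) < 1"
        using den by (simp add: pos_less_divide_eq)
      moreover have "0 \<le> real J * K * \<epsilon>" "0 \<le> K * \<epsilon>" "0 \<le> \<Delta> * \<epsilon>"
        using \<epsilon>1 \<open>K \<ge> 0\<close> \<open>\<Delta> \<ge> 0\<close> by auto
      ultimately have small: "2 * real J * (K * \<epsilon>) < 1" "(K + \<Delta>) * \<epsilon> \<le> 1 / 2"
        using \<epsilon>1 by (auto simp: algebra_simps)
      have A: "?A \<epsilon> = mat J J (\<lambda>(i, j). m \<gamma> \<epsilon> i * (1 / of_nat J) + (if i = j then of_real \<epsilon> * d i else 0))"
        unfolding A_mat_rank_one_plus_diag m_def d_def ..
      obtain l where l: "spectrum (?A \<epsilon>) \<subseteq> cball 0 (K * \<epsilon>) \<union> {l}"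
          "simple_eigenvalue (?A \<epsilon>) l" "dominant_eigenvalue (?A \<epsilon>) l" "norm (l - 1) \<le> K * \<epsilon>"
          "l = 1 + of_real \<epsilon> * ((\<Sum>i<J. m \<gamma> \<epsilon> i * d i / (l - of_real \<epsilon> * d i)) / of_nat J)"
        using rank_one_plus_small_diag_spectrum[where d = d and m = "m \<gamma> \<epsilon>", OF \<open>J > 0\<close> \<epsilon>1(1) B m_avg[of \<gamma> \<epsilon>] m[OF \<epsilon>1] d small(1)[unfolded K_def]]
        unfolding A K_def by blast
      define z where "z = Complex (1 + \<epsilon> * avg J \<alpha> + \<epsilon>\<^sup>2 * (avg J (\<lambda>j. (\<alpha> j)\<^sup>2) - (avg J \<alpha>)\<^sup>2
          - avg J (\<lambda>j. (\<beta> j)\<^sup>2) + (\<epsilon> ^ \<gamma> * q)\<^sup>2)) (\<epsilon> * (\<epsilon> ^ \<gamma> * q))"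
      have "norm (l - z) \<le> L * \<epsilon> ^ 3"
        using secular_expansion[where d = d and m = "m \<gamma> \<epsilon>", OF \<open>J > 0\<close> \<epsilon>1 B m[OF \<epsilon>1] d l(5,4) small(2)]
        unfolding expansion[OF refl refl] z_def L_def .
      then have dist: "\<bar>Re l - Re z\<bar> \<le> L * \<epsilon> ^ 3" "\<bar>Im l - Im z\<bar> \<le> L * \<epsilon> ^ 3"
        using abs_Re_le_cmod[of "l - z"] abs_Im_le_cmod[of "l - z"] by auto
      have "\<bar>Re z - ?re \<epsilon>\<bar> \<le> q\<^sup>2 * \<epsilon> ^ 3"
      proof (cases "\<gamma> = 0")
        case True
        then show ?thesis using \<epsilon>1 by (simp add: z_def re avg_\<beta>v)
      next
        \<comment> \<open>For \<open>\<gamma> = 1\<close> the term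
          \<open>(\<epsilon> * q)\<^sup>2\<close> of the coefficient is only of fourth order in the
          eigenvalue and is absorbed in the error, whence the constant
          \<open>L + q\<^sup>2\<close>.\<close>
        case False
        then have "\<bar>Re z - ?re \<epsilon>\<bar> = q\<^sup>2 * \<epsilon> ^ 4"
          using \<gamma> by (simp add: z_def re power_mult_distrib algebra_simps flip: power_add)
        also have "\<dots> \<le> q\<^sup>2 * \<epsilon> ^ 3"
          using \<epsilon>1 by (intro mult_left_mono power_decreasing) auto
        finally show ?thesis .
      qed
      \<comment> \<open>The imaginary part \<open>\<epsilon> * (\<epsilon> ^ \<gamma> * q)\<close>
        is the first order term for \<open>\<gamma> = 0\<close> and the second order term for
        \<open>\<gamma> = 1\<close>; the mixed average vanishes by \<open>im\<close>.\<close>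
      moreover have "Im z = ?im \<epsilon>"
        using \<gamma> by (auto simp: z_def avg_\<beta>v im power2_eq_square)
      moreover have "0 \<le> q\<^sup>2 * \<epsilon> ^ 3" using \<epsilon>1 by simp
      ultimately have "\<bar>Re l - ?re \<epsilon>\<bar> \<le> (L + q\<^sup>2) * \<epsilon> ^ 3" "\<bar>Im l - ?im \<epsilon>\<bar> \<le> (L + q\<^sup>2) * \<epsilon> ^ 3"
        using dist unfolding distrib_right by linarith+
      moreover have "spectrum (?A \<epsilon>) \<subseteq> cball 0 (\<epsilon> * (4 * B) * \<Delta>) \<union> {l}"
        using l(1) by (simp add: K_def mult_ac)
      ultimately show ?thesis using l(2,3) by blast
    qed
    \<comment> \<open>One eigenvalue is chosen for each \<epsilon>; values outside the interval up
      to \<delta> are arbitrary and do not affect the limit.\<close>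
    define ev where "ev \<epsilon> = (SOME l. ?Q \<epsilon> l)" for \<epsilon>
    have ev: "?Q \<epsilon> (ev \<epsilon>)" if "\<epsilon> \<in> {0<..<\<delta>}" for \<epsilon>
      unfolding ev_def using ex[OF that] by (rule someI_ex)
    have "\<forall>\<^sub>F \<epsilon> in at_right 0. \<epsilon> \<in> {0<..<\<delta>}"
      using den by (intro eventually_at_right_real) (simp add: \<delta>_def)
    then have Q: "\<forall>\<^sub>F \<epsilon> in at_right 0. ?Q \<epsilon> (ev \<epsilon>)"
      by (rule eventually_mono) (rule ev)
    show "\<exists>ev :: real \<Rightarrow> complex.
      (\<forall>\<^sub>F \<epsilon> in at_right 0.
        spectrum (?A \<epsilon>)
          \<subseteq> cball 0 (\<epsilon> * (4 * B) * Max ((\<lambda>j. \<bar>\<alpha> j\<bar> + \<bar>\<beta> j\<bar>) ` {J div 2 + 1..J})) \<union> {ev \<epsilon>} \<and>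
        simple_eigenvalue (?A \<epsilon>) (ev \<epsilon>) \<and> dominant_eigenvalue (?A \<epsilon>) (ev \<epsilon>)) \<and>
      (\<lambda>\<epsilon>. Re (ev \<epsilon>) - ?re \<epsilon>) \<in> o[at_right 0](\<lambda>\<epsilon>. \<epsilon>\<^sup>2) \<and>
      (\<lambda>\<epsilon>. Im (ev \<epsilon>) - ?im \<epsilon>) \<in> o[at_right 0](\<lambda>\<epsilon>. \<epsilon>\<^sup>2)"
      unfolding \<Delta>_def[symmetric]
    proof (intro exI[of _ ev] conjI)
      from Q show "\<forall>\<^sub>F \<epsilon> in at_right 0. spectrum (?A \<epsilon>) \<subseteq> cball 0 (\<epsilon> * (4 * B) * \<Delta>) \<union> {ev \<epsilon>} \<and>
        simple_eigenvalue (?A \<epsilon>) (ev \<epsilon>) \<and> dominant_eigenvalue (?A \<epsilon>) (ev \<epsilon>)"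
        by (rule eventually_mono) (elim conjE, intro conjI)
      show "(\<lambda>\<epsilon>. Re (ev \<epsilon>) - ?re \<epsilon>) \<in> o[at_right 0](\<lambda>\<epsilon>. \<epsilon>\<^sup>2)"
        by (rule smallo_square_if_cube_bound, rule eventually_mono[OF Q]) (elim conjE)
      show "(\<lambda>\<epsilon>. Im (ev \<epsilon>) - ?im \<epsilon>) \<in> o[at_right 0](\<lambda>\<epsilon>. \<epsilon>\<^sup>2)"
        by (rule smallo_square_if_cube_bound, rule eventually_mono[OF Q]) (elim conjE)
    qed
  qed
qed

end
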